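(* If $\lambda\in\mathbb{C}$ is an eigenvalue of $M(\cdot)$ with associated right eigenvector $v_{+}$ and left eigenvector $w_{+}$, then $-\lambda$ is also an eigenvalue of $M(\cdot)$ and the corresponding right and left eigenvectors are $Jw_{+}$ and $Jv_{+}$, respectively.
   Context: Let $n,K$ be positive integers, $0<\tau_1<\dots<\tau_K<\infty$, and let $H_0,H_1,H_{-1},\dots,H_K,H_{-K}\in\mathbb{R}^{2n\times 2n}$. Let $J=\begin{bmatrix}0&I_n\\-I_n&0\end{bmatrix}$. Standing assumption: $(JH_0)^{\top}=JH_0$ and $(JH_{-k})^{\top}=JH_k$ for $k=1,\dots,K$. The characteristic matrix is $$M(\lambda)=\lambda I_{2n}-H_0-\sum_{k=1}^K\left(H_{-k}e^{-\lambda\tau_k}+H_ke^{\lambda\tau_k}\right),\qquad \lambda\in\mathbb{C}.$$ A number $\lambda\in\mathbb{C}$ is an eigenvalue of $M(\cdot)$ if $M(\lambda)$ is singular. A right eigenvector associated with $\lambda$ is a vector $v\in\mathbb{C}^{2n}\setminus\{0\}$ with $M(\lambda)v=0$; a left eigenvector associated with $\lambda$ is a vector $w\in\mathbb{C}^{2n}\setminus\{0\}$ with $w^{\top}M(\lambda)=0$ (plain transpose, no conjugation). *)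

theory Defs
  imports "HOL-Analysis.Analysis"
begin

text \<open>
  Vectors of length \<open>2n\<close> are indexed by the disjoint sum \<open>'n + 'n\<close>, where \<open>CARD('n) = n\<close>:
  \<open>Inl\<close> is the first block of \<open>n\<close> coordinates and \<open>Inr\<close> the second.
\<close>

definition J_mat :: "real ^ ('n::finite + 'n) ^ ('n + 'n)" where
  "J_mat = (\<chi> i j. case (i, j) of
      (Inl a, Inr b) \<Rightarrow> if a = b then 1 else 0
    | (Inr a, Inl b) \<Rightarrow> if a = b then - 1 else 0
    | _ \<Rightarrow> 0)"

abbreviation cmat :: "real ^ 'm ^ 'm \<Rightarrow> complex ^ 'm ^ 'm::finite" where
  "cmat A \<equiv> map_matrix complex_of_real A"

text \<open>
  The coefficient matrices form one family \<open>H\<close> indexed by the integers, of which only the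
  members with index in \<open>{- K..K}\<close> are used; of the delays \<open>\<tau>\<close> only \<open>\<tau> 1, \<dots>, \<tau> K\<close> are used.
\<close>

definition char_mat ::
  "nat \<Rightarrow> (nat \<Rightarrow> real) \<Rightarrow> (int \<Rightarrow> real ^ 'm ^ 'm) \<Rightarrow> complex \<Rightarrow> complex ^ 'm ^ 'm::finite" where
  "char_mat K \<tau> H z = mat z - cmat (H 0)
     - (\<Sum>k = 1..K. map_matrix (\<lambda>h. h * exp (- z * complex_of_real (\<tau> k))) (cmat (H (- int k)))
                   + map_matrix (\<lambda>h. h * exp (z * complex_of_real (\<tau> k))) (cmat (H (int k))))"

definition is_eigenvalue :: "(complex \<Rightarrow> complex ^ 'm ^ 'm::finite) \<Rightarrow> complex \<Rightarrow> bool" where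
  "is_eigenvalue M z \<longleftrightarrow> \<not> invertible (M z)"

definition is_right_eigenvector ::
  "(complex \<Rightarrow> complex ^ 'm ^ 'm::finite) \<Rightarrow> complex \<Rightarrow> complex ^ 'm \<Rightarrow> bool" where
  "is_right_eigenvector M z v \<longleftrightarrow> v \<noteq> 0 \<and> M z *v v = 0"

text \<open>
  The library product \<open>w v* A\<close> is the row vector \<open>w\<close> times \<open>A\<close>, without conjugation.
\<close>

definition is_left_eigenvector ::
  "(complex \<Rightarrow> complex ^ 'm ^ 'm::finite) \<Rightarrow> complex \<Rightarrow> complex ^ 'm \<Rightarrow> bool" where
  "is_left_eigenvector M z w \<longleftrightarrow> w \<noteq> 0 \<and> w v* M z = 0"

end

theory Submission
  imports Defs
begin

text \<open>
  The symmetry assumptions say that the linear involution \<open>A \<mapsto> (J A J)\<^sup>T\<close> fixes \<open>H\<^sub>0\<close> and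
  exchanges \<open>H\<^sub>k\<close> with \<open>H\<^sub>-\<^sub>k\<close>; since \<open>J J = - I\<close>, it also sends \<open>\<lambda> I\<close> to \<open>- \<lambda> I\<close>.  Changing
  the sign of \<open>\<lambda>\<close> in \<open>M(\<lambda>)\<close> exchanges the two exponential factors of each delay, which is
  undone by exchanging \<open>H\<^sub>k\<close> and \<open>H\<^sub>-\<^sub>k\<close>.  The involution therefore sends \<open>M(-\<lambda>)\<close> to \<open>M(\<lambda>)\<close>:
  this is the identity \<open>M(\<lambda>)\<^sup>T = J M(-\<lambda>) J\<close> of \<open>J_adjoint_char_mat\<close>.

  As \<open>w\<^sup>T A = 0\<close> means \<open>A\<^sup>T w = 0\<close>, the identity turns kernel vectors of \<open>M(\<lambda>)\<^sup>T\<close> into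
  kernel vectors of \<open>M(-\<lambda>)\<close> by multiplication with \<open>J\<close>, which is injective.  The same identity at
  \<open>-\<lambda>\<close> does this for \<open>M(\<lambda>)\<close> and \<open>M(-\<lambda>)\<^sup>T\<close>.
\<close>

lemma matrix_mult_minus_left: "(- A) ** B = - (A ** B)"
  for A :: "'a::ring_1 ^ 'n ^ 'm"
  by (simp add: matrix_matrix_mult_def vec_eq_iff sum_negf)

lemma matrix_mult_minus_right: "A ** (- B) = - (A ** B)"
  for A :: "'a::ring_1 ^ 'n ^ 'm"
  by (simp add: matrix_matrix_mult_def vec_eq_iff sum_negf)

lemma matrix_vector_mult_minus_left: "(- A) *v x = - (A *v x)"
  for A :: "'a::ring_1 ^ 'n ^ 'm"
  by (simp add: matrix_vector_mult_def vec_eq_iff sum_negf)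

lemma J_mat_squared: "(J_mat ** J_mat :: real ^ ('n::finite + 'n) ^ ('n + 'n)) = - mat 1"
proof -
  have "(J_mat ** J_mat :: real ^ ('n + 'n) ^ ('n + 'n)) $ i $ j = (- mat 1) $ i $ j" for i j
    by (cases i; cases j)
       (simp_all add: J_mat_def matrix_matrix_mult_def mat_def sum.Plus if_distrib[where f = "\<lambda>x. _ * x"]
          cong: if_cong flip: UNIV_Plus_UNIV)
  then show ?thesis
    by (simp add: vec_eq_iff)
qed

lemma transpose_J_mat: "transpose J_mat = - J_mat"
  by (auto simp: J_mat_def transpose_def vec_eq_iff split: sum.splits)

lemma cmat_mult: "cmat (A ** B) = cmat A ** cmat B"
  by (simp add: map_matrix_def matrix_matrix_mult_def vec_eq_iff)

lemma cmat_J_squared: "cmat J_mat ** cmat J_mat = - mat 1"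
  unfolding cmat_mult[symmetric] J_mat_squared
  by (simp add: map_matrix_def mat_def vec_eq_iff)

lemma cmat_J_mult_vec_twice: "cmat J_mat *v (cmat J_mat *v x) = - x"
  by (simp add: matrix_vector_mul_assoc cmat_J_squared matrix_vector_mult_minus_left)

lemma cmat_J_mult_vec_eq_0_iff: "cmat J_mat *v x = 0 \<longleftrightarrow> x = 0"
  by (metis cmat_J_mult_vec_twice matrix_vector_mult_0_right neg_equal_0_iff_equal)

text \<open>
  Phrasing the symmetry as a relation between two matrices lets it be propagated through the terms
  of the characteristic matrix, each of which is paired with the corresponding term at the negated
  argument.
\<close>

definition J_adjoint ::
  "complex ^ ('n::finite + 'n) ^ ('n + 'n) \<Rightarrow> complex ^ ('n + 'n) ^ ('n + 'n) \<Rightarrow> bool" where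
  "J_adjoint A B \<longleftrightarrow> transpose A = cmat J_mat ** B ** cmat J_mat"

lemma J_adjoint_add: "J_adjoint A B \<Longrightarrow> J_adjoint C D \<Longrightarrow> J_adjoint (A + C) (B + D)"
  by (simp add: J_adjoint_def transpose_def matrix_matrix_mult_def vec_eq_iff sum.distrib
      algebra_simps)

lemma J_adjoint_scale:
  assumes "J_adjoint A B"
  shows "J_adjoint (map_matrix (\<lambda>h. h * c) A) (map_matrix (\<lambda>h. h * c) B)"
proof -
  have "transpose (map_matrix (\<lambda>h. h * c) A) = map_matrix (\<lambda>h. h * c) (transpose A)"
    by (simp add: transpose_def map_matrix_def vec_eq_iff)
  also have "\<dots> = map_matrix (\<lambda>h. h * c) (cmat J_mat ** B ** cmat J_mat)"
    using assms by (simp add: J_adjoint_def)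
  also have "\<dots> = cmat J_mat ** map_matrix (\<lambda>h. h * c) B ** cmat J_mat"
    by (simp add: map_matrix_def matrix_matrix_mult_def vec_eq_iff sum_distrib_left
        sum_distrib_right algebra_simps)
  finally show ?thesis
    by (simp add: J_adjoint_def)
qed

lemma J_adjoint_diff:
  fixes A B C D :: "complex ^ ('n::finite + 'n) ^ ('n + 'n)"
  assumes "J_adjoint A B" and "J_adjoint C D"
  shows "J_adjoint (A - C) (B - D)"
proof -
  have "map_matrix (\<lambda>h. h * (- 1)) X = - X" for X :: "complex ^ ('n + 'n) ^ ('n + 'n)"
    by (simp add: map_matrix_def vec_eq_iff)
  then have "J_adjoint (- C) (- D)"
    using J_adjoint_scale[OF assms(2), of "- 1"] by simp
  with assms(1) show ?thesis
    using J_adjoint_add by fastforce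
qed

lemma J_adjoint_sum:
  "(\<And>k. k \<in> S \<Longrightarrow> J_adjoint (A k) (B k)) \<Longrightarrow> J_adjoint (\<Sum>k\<in>S. A k) (\<Sum>k\<in>S. B k)"
proof (induction S rule: infinite_finite_induct)
  case (insert k S)
  then show ?case
    by (simp add: J_adjoint_add)
qed (simp_all add: J_adjoint_def transpose_def matrix_matrix_mult_def vec_eq_iff)

text \<open>
  The identity matrix is paired with its negative because \<open>J J = - I\<close>; this is what reverses the
  sign of the spectral parameter.
\<close>

lemma J_adjoint_mat: "J_adjoint (mat z) (mat (- z))"
proof -
  have "J_adjoint (mat 1) (- mat 1)"
    by (simp add: J_adjoint_def matrix_mult_minus_right matrix_mult_minus_left cmat_J_squared)
  from J_adjoint_scale[OF this, of z] show ?thesis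
    by (simp add: map_matrix_def mat_def vec_eq_iff if_distrib[where f = "\<lambda>h. h * z"]
        if_distrib[where f = uminus] cong: if_cong)
qed

text \<open>
  Multiplying \<open>(J X)\<^sup>T = - X\<^sup>T J\<close> on the right by \<open>J\<close> isolates \<open>X\<^sup>T\<close>.
\<close>

lemma J_adjoint_cmat:
  assumes "transpose (J_mat ** X) = J_mat ** Y"
  shows "J_adjoint (cmat X) (cmat Y)"
proof -
  have "J_mat ** Y ** J_mat = - (transpose X ** J_mat) ** J_mat"
    using assms by (simp add: matrix_transpose_mul transpose_J_mat matrix_mult_minus_right)
  also have "\<dots> = transpose X"
    by (simp add: matrix_mult_minus_left matrix_mult_minus_right J_mat_squared flip: matrix_mul_assoc)
  finally have "cmat (transpose X) = cmat J_mat ** cmat Y ** cmat J_mat"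
    by (simp flip: cmat_mult)
  moreover have "transpose (cmat X) = cmat (transpose X)"
    by (simp add: transpose_def map_matrix_def vec_eq_iff)
  ultimately show ?thesis
    by (simp add: J_adjoint_def)
qed

lemma J_adjoint_char_mat:
  assumes H0: "transpose (J_mat ** H 0) = J_mat ** H 0"
    and Hk: "\<forall>k\<in>{1..K}. transpose (J_mat ** H (- int k)) = J_mat ** H (int k)"
  shows "J_adjoint (char_mat K \<tau> H z) (char_mat K \<tau> H (- z))"
proof -
  let ?E = "\<lambda>c X. map_matrix (\<lambda>h. h * exp c) (cmat X)"
  have "J_adjoint (?E (- z * \<tau> k) (H (- int k)) + ?E (z * \<tau> k) (H (int k)))
      (?E (z * \<tau> k) (H (- int k)) + ?E (- z * \<tau> k) (H (int k)))" if "k \<in> {1..K}" for k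
  proof -
    have neg: "transpose (J_mat ** H (- int k)) = J_mat ** H (int k)"
      using Hk that by blast
    then have pos: "transpose (J_mat ** H (int k)) = J_mat ** H (- int k)"
      by (metis transpose_transpose)
    \<comment> \<open>The adjoint of each summand is the second matrix's other summand, whose exponential is the same.\<close>
    show ?thesis
      unfolding add.commute[of "?E (z * \<tau> k) (H (- int k))"]
      by (intro J_adjoint_add J_adjoint_scale J_adjoint_cmat neg pos)
  qed
  then show ?thesis
    unfolding char_mat_def minus_minus
    by (intro J_adjoint_diff J_adjoint_mat J_adjoint_cmat[OF H0] J_adjoint_sum)
qed

lemma J_adjoint_mult_vec:
  assumes "J_adjoint A B"
  shows "transpose A *v x = cmat J_mat *v (B *v (cmat J_mat *v x))"
  using assms by (simp add: J_adjoint_def matrix_vector_mul_assoc matrix_mul_assoc)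

theorem proposition2p2:
  fixes K :: nat
    and \<tau> :: "nat \<Rightarrow> real"
    and H :: "int \<Rightarrow> real ^ ('n::finite + 'n) ^ ('n + 'n)"
    and z :: complex
    and v w :: "complex ^ ('n + 'n)"
  assumes "K \<ge> 1"
    and "\<forall>k\<in>{1..K}. 0 < \<tau> k"
    and "strict_mono_on {1..K} \<tau>"
    and "transpose (J_mat ** H 0) = J_mat ** H 0"
    and "\<forall>k\<in>{1..K}. transpose (J_mat ** H (- int k)) = J_mat ** H (int k)"
    and "is_eigenvalue (char_mat K \<tau> H) z"
    and "is_right_eigenvector (char_mat K \<tau> H) z v"
    and "is_left_eigenvector (char_mat K \<tau> H) z w"
  shows "is_eigenvalue (char_mat K \<tau> H) (- z)
    \<and> is_right_eigenvector (char_mat K \<tau> H) (- z) (cmat J_mat *v w)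
    \<and> is_left_eigenvector (char_mat K \<tau> H) (- z) (cmat J_mat *v v)"
proof -
  let ?M = "char_mat K \<tau> H" and ?J = "cmat J_mat :: complex ^ ('n + 'n) ^ ('n + 'n)"
  note symmetry = J_adjoint_char_mat[OF assms(4,5), of \<tau>]
  have v: "v \<noteq> 0" "?M z *v v = 0"
    using assms(7) by (simp_all add: is_right_eigenvector_def)
  have w: "w \<noteq> 0" "transpose (?M z) *v w = 0"
    using assms(8) by (simp_all add: is_left_eigenvector_def)

  have Jw: "?J *v w \<noteq> 0" "?M (- z) *v (?J *v w) = 0"
    using w J_adjoint_mult_vec[OF symmetry[of z], of w]
    by (simp_all add: cmat_J_mult_vec_eq_0_iff)
  have "transpose (?M (- z)) *v (?J *v v) = ?J *v (?M z *v (?J *v (?J *v v)))"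
    using J_adjoint_mult_vec[OF symmetry[of "- z"]] by simp
  also have "\<dots> = 0"
    using v(2) by (simp add: cmat_J_mult_vec_twice vec.neg)
  finally have Jv: "?J *v v \<noteq> 0" "transpose (?M (- z)) *v (?J *v v) = 0"
    using v(1) by (simp_all add: cmat_J_mult_vec_eq_0_iff)
  have "\<not> invertible (?M (- z))"
    using Jw by (metis invertible_def matrix_left_invertible_ker)
  with Jw Jv show ?thesis
    by (simp add: is_eigenvalue_def is_right_eigenvector_def is_left_eigenvector_def)
qed

end
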